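(* Let $\delta\in(0,1)$, and let $P$ be a probability distribution supported on a finite set $\{a_1,\dots,a_k\}$ of size $k\ge2$, with $p_j=P(\{a_j\})$. Let $(X_t)_{t\ge1}$ be i.i.d. from $P$ with empirical measure $P_t=\frac1t\sum_{i=1}^t\delta_{X_i}$. For $\lambda\in[0,1]$ and integers $t\ge1$ define $$G_{k,t}(\lambda)=\sum_{x_1,\dots,x_k}\binom{t}{x_1,\dots,x_k}\prod_{i=1}^k\big[\lambda x_i/t+(1-\lambda)p_i\big]^{x_i},$$ the sum being over nonnegative integers with $x_1+\dots+x_k=t$, and set $G_{k,0}(\lambda)=1$. Let $\ell:[0,\infty)\to[1,\infty)$ satisfy $\sum_{j=1}^\infty1/\ell(j)\le1$, $\ell(x)=\ell(1)$ for all $x\in[0,1]$, and $u\mapsto2^{-u}\log\ell(u)$ decreasing (not necessarily strictly) on $[1,\infty)$. Let $(\lambda_t)_{t=1}^\infty\subseteq(0,1/2]$ be a sequence of real numbers such that $$\gamma_t=\frac{2}{\lambda_tt}\log\left(\frac{G_{k,\lfloor t/2\rfloor}(2\lambda_t)\,\ell(\log_2t)}{\delta}\right),\quad t\ge1,$$ is a nonincreasing sequence in $t$. Then $$\mathbb{P}\{\exists t\ge1:\mathrm{KL}(P_t\|P)\ge\gamma_t\}\le\delta.$$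
   Context: $\mathrm{KL}(\mu\|P)=\int\log\left(\frac{d\mu}{dP}\right)d\mu$ is the Kullback–Leibler divergence (with $0\log0=0$). $\binom{t}{x_1,\dots,x_k}$ is the multinomial coefficient; $0^0=1$. *)

theory Defs
  imports "HOL-Probability.Probability"
begin

(* KL(\<mu> || P), with value \<infinity> when \<mu> is not absolutely continuous w.r.t. P or when the
   log-density is not \<mu>-integrable. In these cases the real-valued library constant
   KL_divergence is a junk value. Note the argument order of the library:
   KL_divergence b P \<mu> is the divergence of \<mu> from P. *)
definition KL :: "'a measure \<Rightarrow> 'a measure \<Rightarrow> ereal" where
  "KL \<mu> P =
     (if absolutely_continuous P \<mu> \<and> integrable \<mu> (entropy_density (exp 1) P \<mu>)
      then ereal (KL_divergence (exp 1) P \<mu>) else \<infinity>)"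

(* For t \<ge> 1: the law of xs I with I uniform on {1..t}; see measure_empirical below.
   The value at t = 0 has no meaning. *)
definition empirical :: "nat \<Rightarrow> (nat \<Rightarrow> 'a) \<Rightarrow> 'a pmf" where
  "empirical t xs = map_pmf xs (pmf_of_set {1..t})"

lemma measure_empirical:
  assumes "t \<ge> 1"
  shows "measure (empirical t xs) S = (1 / real t) * (\<Sum>i=1..t. indicator S (xs i))"
proof -
  have "measure (empirical t xs) S = measure (pmf_of_set {1..t}) (xs -` S)"
    by (simp add: empirical_def)
  also have "\<dots> = real (card ({1..t} \<inter> xs -` S)) / real t"
    using assms by (subst measure_pmf_of_set) auto
  also have "real (card ({1..t} \<inter> xs -` S)) = (\<Sum>i=1..t. indicator S (xs i))"
    by (simp add: indicator_def sum.If_cases vimage_def Int_def)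
  finally show ?thesis by simp
qed

definition compositions :: "nat \<Rightarrow> nat \<Rightarrow> (nat \<Rightarrow> nat) set" where
  "compositions k t = {x \<in> {1..k} \<rightarrow>\<^sub>E {..t}. (\<Sum>i=1..k. x i) = t}"

definition multinomial :: "nat \<Rightarrow> nat \<Rightarrow> (nat \<Rightarrow> nat) \<Rightarrow> real" where
  "multinomial k t x = fact t / (\<Prod>i=1..k. fact (x i))"

definition G :: "(nat \<Rightarrow> real) \<Rightarrow> nat \<Rightarrow> nat \<Rightarrow> real \<Rightarrow> real" where
  "G p k t l =
     (\<Sum>x\<in>compositions k t. multinomial k t x *
        (\<Prod>i=1..k. (l * real (x i) / real t + (1 - l) * p i) ^ x i))"

lemma compositions_0: "compositions k 0 = {\<lambda>i. if i \<in> {1..k} then 0 else undefined}"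
proof -
  have "x = (\<lambda>i. if i \<in> {1..k} then 0 else undefined)"
    if "x \<in> {1..k} \<rightarrow>\<^sub>E {0}" for x :: "nat \<Rightarrow> nat"
    using that by (intro ext) (auto simp: PiE_iff extensional_def)
  then show ?thesis
    by (fastforce simp: compositions_def PiE_iff extensional_def)
qed

lemma G_0: "G p k 0 l = 1"
  by (simp add: G_def compositions_0 multinomial_def)

definition threshold ::
  "(nat \<Rightarrow> real) \<Rightarrow> nat \<Rightarrow> (real \<Rightarrow> real) \<Rightarrow> (nat \<Rightarrow> real) \<Rightarrow> real \<Rightarrow> nat \<Rightarrow> real" where
  "threshold p k ell lam \<delta> t =
     2 / (lam t * real t) *
     ln (G p k (t div 2) (2 * lam t) * ell (log 2 (real t)) / \<delta>)"

end

(* Cut time into the dyadic blocks [m, 2m) with m = 2^j. As gamma is nonincreasing, a crossing in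
   the block is a crossing of the constant level gamma(2m) by some KL(P_t || P) with m <= t < 2m.
   KL is convex and P_t is the average of the empirical measures of all windows of m consecutive
   (cyclically) observations among the first t, so t |-> KL(P_t || P) is a reverse submartingale;
   Doob's inequality for exp(s KL), read from t = 2m - 1 down to t = m, bounds the crossing
   probability by exp(-s gamma(2m)) E exp(s KL(P_m || P)). Take s = 2 lam(2m) m. Weighted AM-GM
   bounds the expectation by g = G_{k,m}(2 lam(2m)) >= 1, and then the bound
   (delta / (g ell(j+1)))^2 g is at most delta / ell(j+1), which sums to at most delta.
   The observations take finitely many values almost surely, so everything is a finite sum over words. *)
theory Submission
  imports Defs "HOL-Combinatorics.Multiset_Permutations"
begin

section \<open>Divergence of a finite sample, and words with their probabilities\<close>

text \<open>The divergence of the empirical measure of \<open>A\<close> from \<open>P\<close> as a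
  finite sum. Taking a multiset makes it blind to the order of the sample, which the reverse-time
  argument exploits. Letters outside the support get no summand, so the link to \<open>KL\<close> is
  made only for samples inside it.\<close>

definition relent :: "'a pmf \<Rightarrow> 'a multiset \<Rightarrow> real" where
  "relent P A = (\<Sum>b\<in>set_pmf P.
     real (count A b) / real (size A) * ln (real (count A b) / real (size A) / pmf P b))"

definition words :: "'a pmf \<Rightarrow> nat \<Rightarrow> 'a list set" where
  "words P n = {xs. set xs \<subseteq> set_pmf P \<and> length xs = n}"

text \<open>The probability that the first \<open>length xs\<close> observations spell
  \<open>xs\<close>.\<close>

definition weight :: "'a pmf \<Rightarrow> 'a list \<Rightarrow> real" where
  "weight P xs = (\<Prod>x\<leftarrow>xs. pmf P x)"

section \<open>Convexity of the divergence over cyclic windows\<close>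

text \<open>The right-hand side is the tangent at \<open>y\<close> of the convex function
  \<open>x * ln (x / p)\<close>. Nonnegativity and convexity of the divergence both come from
  it.\<close>

lemma mult_ln_tangent:
  fixes x y p :: real
  assumes "x \<ge> 0" "y > 0" "p > 0"
  shows "x * ln (x / p) \<ge> x * ln (y / p) + x - y"
proof (cases "x = 0")
  case True
  then show ?thesis using assms by simp
next
  case False
  then have x: "x > 0" using assms by simp
  have "ln (y / x) \<le> y / x - 1"
    using x assms by (intro ln_le_minus_one) simp
  then have "x * ln (y / x) \<le> x * (y / x - 1)"
    using x by (intro mult_left_mono) auto
  also have "\<dots> = y - x" using x by (simp add: field_simps)
  finally have "x * (ln y - ln x) \<le> y - x" using x assms by (simp add: ln_div)
  then show ?thesis using x assms by (simp add: ln_div algebra_simps)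
qed

lemma mset_rotate: "mset (rotate r xs) = mset xs"
  by (metis append_take_drop_id mset_append rotate_drop_take union_commute)

lemma count_mset_conv_nth:
  "count (mset xs) b = (\<Sum>i<length xs. of_bool (xs ! i = b))"
  proof (induction xs rule: rev_induct)
  case (snoc x xs)
  have "(\<Sum>i<length xs. of_bool ((xs @ [x]) ! i = b)) = (\<Sum>i<length xs. of_bool (xs ! i = b) :: nat)"
    by (intro sum.cong) (auto simp: nth_append)
  with snoc show ?case by (simp del: sum_of_bool_eq)
qed simp

text \<open>Every cyclic position of \<open>u\<close> lies in exactly \<open>m\<close> windows:
  lengthening all windows by one letter covers each position once more.\<close>

lemma sum_count_take_rotate:
  assumes "m \<le> length u"
  shows "(\<Sum>r<length u. count (mset (take m (rotate r u))) b) = m * count (mset u) b"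
  using assms
proof (induction m)
  case (Suc m)
  \<comment> \<open>Both sides are the letter of \<open>u\<close> at position r + m modulo its
    length.\<close>
  have swap: "rotate r u ! m = rotate m u ! r" if "r < length u" for r
    using that Suc.prems by (simp add: nth_rotate add.commute)
  have "(\<Sum>r<length u. count (mset (take (Suc m) (rotate r u))) b) =
        (\<Sum>r<length u. count (mset (take m (rotate r u))) b + of_bool (rotate r u ! m = b))"
    using Suc.prems by (intro sum.cong) (auto simp: take_Suc_conv_app_nth)
  also have "\<dots> = m * count (mset u) b + (\<Sum>r<length u. of_bool (rotate m u ! r = b))"
    using Suc by (simp add: sum.distrib swap)
  also have "(\<Sum>r<length u. of_bool (rotate m u ! r = b)) = count (mset (rotate m u)) b"
    by (simp add: count_mset_conv_nth)
  finally show ?case by (simp add: mset_rotate)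
qed simp

text \<open>Gibbs' inequality: the tangent at \<open>pmf P b\<close> leaves only
  \<open>?q b - pmf P b\<close>, and both vectors sum to 1 over the support.\<close>

lemma relent_nonneg:
  assumes "finite (set_pmf P)" "set_mset A \<subseteq> set_pmf P" "A \<noteq> {#}"
  shows "relent P A \<ge> 0"
proof -
  let ?q = "\<lambda>b. real (count A b) / real (size A)"
  have "(\<Sum>b\<in>set_pmf P. count A b) = size A"
    unfolding size_multiset_overloaded_eq using assms
    by (intro sum.mono_neutral_right) (auto simp: not_in_iff)
  then have "(\<Sum>b\<in>set_pmf P. ?q b) = 1"
    using assms by (simp flip: sum_divide_distrib of_nat_sum)
  moreover have "(\<Sum>b\<in>set_pmf P. pmf P b) = 1"
    using assms by (simp add: sum_pmf_eq_1)
  ultimately have "0 = (\<Sum>b\<in>set_pmf P. ?q b - pmf P b)"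
    by (simp add: sum_subtractf)
  also have "\<dots> \<le> relent P A"
    unfolding relent_def
  proof (intro sum_mono)
    fix b assume "b \<in> set_pmf P"
    then have "pmf P b > 0" by (simp add: pmf_positive)
    then show "?q b - pmf P b \<le> ?q b * ln (?q b / pmf P b)"
      using mult_ln_tangent[of "?q b" "pmf P b" "pmf P b"] by simp
  qed
  finally show ?thesis .
qed

text \<open>Convexity of the divergence, applied to the cyclic windows of length \<open>m\<close> of \<open>u\<close>: the average
  of their empirical measures is the empirical measure of \<open>u\<close>.\<close>
lemma relent_rotate_average:
  assumes "0 < m" "m \<le> length u"
  shows "length u * relent P (mset u) \<le> (\<Sum>r<length u. relent P (mset (take m (rotate r u))))"
proof -
  define n where "n = length u"
  define q where "q = (\<lambda>b. real (count (mset u) b) / n)"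
  define q' where "q' = (\<lambda>r b. real (count (mset (take m (rotate r u))) b) / m)"
  have n: "n > 0" "m \<le> n" using assms by (auto simp: n_def)
  have sum_q': "(\<Sum>r<n. q' r b) = n * q b" for b
  proof -
    have "(\<Sum>r<n. q' r b) = real (\<Sum>r<n. count (mset (take m (rotate r u))) b) / m"
      by (simp add: q'_def sum_divide_distrib)
    also have "\<dots> = n * q b"
      unfolding n_def using assms sum_count_take_rotate[of m u b] n by (simp add: q_def n_def)
    finally show ?thesis .
  qed
  have "n * (q b * ln (q b / pmf P b)) \<le> (\<Sum>r<n. q' r b * ln (q' r b / pmf P b))"
    if b: "b \<in> set_pmf P" for b
  proof (cases "q b = 0")
    \<comment> \<open>There is no tangent at 0, but nonnegative terms with sum 0 all vanish, so both
      sides are 0.\<close>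
    case True
    then have "(\<Sum>r<n. q' r b) = 0" by (simp add: sum_q')
    then have "\<forall>r\<in>{..<n}. q' r b = 0"
      by (subst (asm) sum_nonneg_eq_0_iff) (auto simp: q'_def)
    then show ?thesis using True by simp
  next
    case False
    then have q: "q b > 0" by (simp add: q_def)
    have p: "pmf P b > 0" using b by (simp add: pmf_positive)
    \<comment> \<open>Tangents are taken at the mean \<open>q b\<close>, so by \<open>sum_q'\<close>
      the corrections \<open>q' r b - q b\<close> cancel.\<close>
    have "n * (q b * ln (q b / pmf P b)) = (\<Sum>r<n. q' r b * ln (q b / pmf P b) + q' r b - q b)"
      by (simp add: sum.distrib sum_subtractf sum_q' flip: sum_distrib_right)
    also have "\<dots> \<le> (\<Sum>r<n. q' r b * ln (q' r b / pmf P b))"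
      using q p by (intro sum_mono mult_ln_tangent) (auto simp: q'_def)
    finally show ?thesis .
  qed
  then have "(\<Sum>b\<in>set_pmf P. n * (q b * ln (q b / pmf P b)))
      \<le> (\<Sum>b\<in>set_pmf P. \<Sum>r<n. q' r b * ln (q' r b / pmf P b))"
    by (intro sum_mono) auto
  also have "\<dots> = (\<Sum>r<n. \<Sum>b\<in>set_pmf P. q' r b * ln (q' r b / pmf P b))"
    by (rule sum.swap)
  finally show ?thesis
    using assms
    by (simp add: relent_def q_def q'_def n_def min_absorb2 sum_distrib_left)
qed

text \<open>Jensen via the tangent of exp at \<open>c\<close>: the mean of the \<open>d r\<close> is
  at least \<open>c\<close>, so the tangent values add up to at least
  \<open>n * exp c\<close>.\<close>

lemma exp_relent_rotate_average:
  assumes "0 < m" "m \<le> length u" "s \<ge> 0"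
  shows "length u * exp (s * relent P (mset u))
    \<le> (\<Sum>r<length u. exp (s * relent P (mset (take m (rotate r u)))))"
proof -
  define n where "n = length u"
  define c where "c = s * relent P (mset u)"
  define d where "d = (\<lambda>r. s * relent P (mset (take m (rotate r u))))"
  have "n * c \<le> (\<Sum>r<n. d r)"
    using mult_left_mono[OF relent_rotate_average[OF assms(1,2), of P] assms(3)]
    by (simp add: c_def d_def n_def sum_distrib_left mult_ac)
  then have "exp c * (n * c) \<le> exp c * (\<Sum>r<n. d r)"
    by (intro mult_left_mono) auto
  then have "n * exp c \<le> (\<Sum>r<n. exp c * (1 + (d r - c)))"
    by (simp add: sum.distrib sum_subtractf algebra_simps flip: sum_distrib_left)
  also have "\<dots> \<le> (\<Sum>r<n. exp c * exp (d r - c))"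
    by (intro sum_mono mult_left_mono exp_ge_add_one_self) auto
  also have "\<dots> = (\<Sum>r<n. exp (d r))"
    by (simp flip: exp_add)
  finally show ?thesis by (simp add: n_def c_def d_def)
qed

section \<open>Product weights on words and their exchangeability\<close>

lemma finite_words: "finite (set_pmf P) \<Longrightarrow> finite (words P n)"
  unfolding words_def by (rule finite_lists_length_eq)

lemma weight_nonneg: "weight P xs \<ge> 0"
  unfolding weight_def by (rule prod_list_nonneg) auto

lemma weight_append: "weight P (xs @ ys) = weight P xs * weight P ys"
  by (simp add: weight_def)

lemma weight_cong_mset: "mset xs = mset ys \<Longrightarrow> weight P xs = weight P ys"
  unfolding weight_def by (metis mset_map prod_mset_prod_list)

lemma sum_words_append:
  assumes "finite (set_pmf P)"
  shows "(\<Sum>xs\<in>words P (m + n). f xs) = (\<Sum>u\<in>words P m. \<Sum>v\<in>words P n. f (u @ v))"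
proof -
  have "(\<Sum>u\<in>words P m. \<Sum>v\<in>words P n. f (u @ v)) = (\<Sum>(u,v)\<in>words P m \<times> words P n. f (u @ v))"
    using assms by (subst sum.cartesian_product) (auto simp: finite_words)
  also have "\<dots> = (\<Sum>xs\<in>words P (m + n). f xs)"
    by (rule sum.reindex_bij_witness[where i = "\<lambda>xs. (take m xs, drop m xs)" and j = "\<lambda>(u,v). u @ v"])
       (auto simp: words_def dest: in_set_takeD in_set_dropD)
  finally show ?thesis by simp
qed

lemma sum_weight_words:
  assumes "finite (set_pmf P)"
  shows "(\<Sum>xs\<in>words P n. weight P xs) = 1"
proof (induction n)
  case 0
  have "words P 0 = {[]}" by (auto simp: words_def)
  then show ?case by (simp add: weight_def)
next
  case (Suc n)
  have "(\<Sum>u\<in>words P 1. weight P u) = (\<Sum>x\<in>set_pmf P. pmf P x)"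
    by (rule sum.reindex_bij_witness[where i = "\<lambda>x. [x]" and j = hd])
       (auto simp: words_def weight_def length_Suc_conv)
  also have "\<dots> = 1" using assms by (simp add: sum_pmf_eq_1)
  finally show ?case
    using sum_words_append[OF assms, of "weight P" n 1] Suc
    by (simp add: weight_append flip: sum_distrib_left)
qed

text \<open>The letters after position \<open>m\<close> integrate out, since their weights sum to
  1.\<close>

lemma sum_weight_take:
  assumes "finite (set_pmf P)" "m \<le> n"
  shows "(\<Sum>xs\<in>words P n. weight P xs * f (take m xs)) = (\<Sum>u\<in>words P m. weight P u * f u)"
proof -
  obtain d where n: "n = m + d" using assms(2) le_Suc_ex by blast
  have "(\<Sum>xs\<in>words P n. weight P xs * f (take m xs)) =
        (\<Sum>u\<in>words P m. \<Sum>v\<in>words P d. weight P (u @ v) * f (take m (u @ v)))"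
    unfolding n by (rule sum_words_append[OF assms(1)])
  also have "\<dots> = (\<Sum>u\<in>words P m. weight P u * f u * (\<Sum>v\<in>words P d. weight P v))"
    unfolding sum_distrib_left
    by (intro sum.cong) (auto simp: weight_append words_def)
  finally show ?thesis by (simp add: sum_weight_words[OF assms(1)])
qed

text \<open>Exchangeability. The hypothesis on \<open>T\<close> says that \<open>T\<close> belongs to the reverse filtration at
  time \<open>t\<close>: it sees the first \<open>t\<close> letters only through their multiset.\<close>
lemma sum_rotate_prefix:
  assumes "t \<le> n" "r \<le> t" "T \<subseteq> words P n"
    and inv: "\<And>xs ys. \<lbrakk>xs \<in> T; length ys = n; mset (take t xs) = mset (take t ys);
                      drop t xs = drop t ys\<rbrakk> \<Longrightarrow> ys \<in> T"
  shows "(\<Sum>xs\<in>T. weight P xs * f (rotate r (take t xs))) = (\<Sum>xs\<in>T. weight P xs * f (take t xs))"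
proof -
  define R where "R = (\<lambda>r xs. rotate r (take t xs) @ drop t xs :: 'a list)"
  have len: "length xs = n" if "xs \<in> T" for xs
    using that assms(3) by (auto simp: words_def)
  have T: "R r xs \<in> T" if "xs \<in> T" for r xs
    using that len[OF that] assms(1) by (intro inv[OF that]) (auto simp: R_def mset_rotate)
  \<comment> \<open>Rotating the prefix by \<open>t - r\<close> undoes the rotation by
    \<open>r\<close>, so \<open>R r\<close> is a weight-preserving bijection of
    \<open>T\<close>.\<close>
  have R2: "R j (R i xs) = xs" if "xs \<in> T" "i + j = t" for i j xs
    using that len[OF that(1)] assms(1)
    by (simp add: R_def rotate_rotate add.commute[of j])
  have w: "weight P (R r xs) = weight P xs" for r xs
    by (rule weight_cong_mset)
       (simp add: R_def mset_rotate, metis append_take_drop_id mset_append)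
  show ?thesis
    using assms(1,2)
    by (intro sum.reindex_bij_witness[where i = "R (t - r)" and j = "R r"])
       (auto simp: T R2 w, auto simp: R_def len)
qed


section \<open>The maximal inequality in reverse time\<close>

text \<open>Words are split by the time \<open>t\<close> of their last crossing. There the factor
  \<open>exp (s * (K t xs - g))\<close> is at least 1. Convexity bounds
  \<open>exp (s * K t xs)\<close> by the average over the windows of length \<open>m\<close>, and
  exchangeability lets the first \<open>m\<close> letters stand for every window. The pieces are
  disjoint and add up to at most the moment at time \<open>m\<close>.\<close>

lemma sum_weight_maximal:
  assumes fin: "finite (set_pmf P)" and m: "0 < m" "m \<le> n" and s: "s \<ge> 0"
  shows "(\<Sum>xs | xs \<in> words P n \<and> (\<exists>t\<in>{m..n}. relent P (mset (take t xs)) \<ge> g). weight P xs)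
    \<le> exp (- (s * g)) * (\<Sum>u\<in>words P m. weight P u * exp (s * relent P (mset u)))"
proof -
  define K where "K = (\<lambda>t xs. relent P (mset (take t xs)))"
  \<comment> \<open>\<open>T t\<close>: the last crossing, i.e. the first one in reverse time, is at \<open>t\<close>\<close>
  define T where "T = (\<lambda>t. {xs \<in> words P n. K t xs \<ge> g \<and> (\<forall>r\<in>{t<..n}. K r xs < g)})"
  have finT: "finite (T t)" for t
    using finite_words[OF fin] by (auto simp: T_def)
  have disj: "T t \<inter> T t' = {}" if "t < t'" "t' \<le> n" for t t'
    using that by (force simp: T_def)
  have disj': "\<forall>i\<in>{m..n}. \<forall>j\<in>{m..n}. i \<noteq> j \<longrightarrow> T i \<inter> T j = {}"
    using disj by (metis atLeastAtMost_iff inf_commute linorder_neqE_nat)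
  have "{xs \<in> words P n. \<exists>t\<in>{m..n}. K t xs \<ge> g} \<subseteq> (\<Union>t\<in>{m..n}. T t)"
  proof
    fix xs assume "xs \<in> {xs \<in> words P n. \<exists>t\<in>{m..n}. K t xs \<ge> g}"
    then have xs: "xs \<in> words P n" and ne: "{t\<in>{m..n}. K t xs \<ge> g} \<noteq> {}" by auto
    define t where "t = Max {t\<in>{m..n}. K t xs \<ge> g}"
    have t: "t \<in> {t\<in>{m..n}. K t xs \<ge> g}"
      unfolding t_def using ne by (intro Max_in) auto
    have "K r xs < g" if "r \<in> {t<..n}" for r
    proof (rule ccontr)
      assume "\<not> K r xs < g"
      then have "r \<le> t" unfolding t_def using that t by (intro Max_ge) auto
      then show False using that by auto
    qed
    then show "xs \<in> (\<Union>t\<in>{m..n}. T t)" using xs t by (auto simp: T_def)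
  qed
  moreover have "(\<Union>t\<in>{m..n}. T t) \<subseteq> {xs \<in> words P n. \<exists>t\<in>{m..n}. K t xs \<ge> g}"
    by (auto simp: T_def)
  ultimately have "{xs \<in> words P n. \<exists>t\<in>{m..n}. K t xs \<ge> g} = (\<Union>t\<in>{m..n}. T t)" by blast
  then have "(\<Sum>xs | xs \<in> words P n \<and> (\<exists>t\<in>{m..n}. K t xs \<ge> g). weight P xs)
      = (\<Sum>t\<in>{m..n}. \<Sum>xs\<in>T t. weight P xs)"
    using finT disj' by (simp add: sum.UNION_disjoint)
  also have "\<dots> \<le> (\<Sum>t\<in>{m..n}. \<Sum>xs\<in>T t. exp (- (s * g)) * (weight P xs * exp (s * K m xs)))"
  proof (rule sum_mono)
    fix t assume t: "t \<in> {m..n}"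
    define f where "f = (\<lambda>u. exp (s * relent P (mset (take m u))))"
    \<comment> \<open>\<open>T t\<close> involves divergences at times \<open>r >= t\<close> only,
      and these see the first \<open>t\<close> letters through their multiset.\<close>
    have inv: "ys \<in> T t" if "xs \<in> T t" "length ys = n" "mset (take t xs) = mset (take t ys)"
      "drop t xs = drop t ys" for xs ys
    proof -
      have len: "length xs = n" using that by (auto simp: T_def words_def)
      have "mset (take r ys) = mset (take r xs)" if "r \<ge> t" for r
      proof -
        have split: "take r zs = take t zs @ take (r - t) (drop t zs)" for zs :: "'a list"
          using that by (metis le_add_diff_inverse take_add)
        show ?thesis
          using \<open>mset (take t xs) = mset (take t ys)\<close> \<open>drop t xs = drop t ys\<close>
          by (simp add: split[of xs] split[of ys])
      qed
      then have K: "K r ys = K r xs" if "r \<ge> t" for r using that by (simp add: K_def)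
      have "mset ys = mset xs"
        using that(3,4) by (metis append_take_drop_id mset_append)
      then have "set ys = set xs" by (rule mset_eq_setD)
      then have "ys \<in> words P n" using that by (auto simp: T_def words_def)
      then show ?thesis using that(1) K by (auto simp: T_def)
    qed
    \<comment> \<open>The factor \<open>t\<close> turns the average over the \<open>t\<close> cyclic
      windows into a plain sum.\<close>
    have "real t * (\<Sum>xs\<in>T t. weight P xs)
        \<le> (\<Sum>xs\<in>T t. exp (- (s * g)) * (weight P xs * (real t * exp (s * K t xs))))"
      unfolding sum_distrib_left
    proof (intro sum_mono)
      fix xs assume "xs \<in> T t"
      then have "g \<le> K t xs" by (simp add: T_def)
      then have "s * g \<le> s * K t xs" using s by (rule mult_left_mono)
      then have "1 \<le> exp (- (s * g)) * exp (s * K t xs)" by (simp flip: exp_add)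
      then have "real t * weight P xs * 1 \<le> real t * weight P xs * (exp (- (s * g)) * exp (s * K t xs))"
        by (intro mult_left_mono) (auto simp: weight_nonneg)
      then show "real t * weight P xs \<le> exp (- (s * g)) * (weight P xs * (real t * exp (s * K t xs)))"
        by (simp add: mult_ac)
    qed
    also have "\<dots> \<le> (\<Sum>xs\<in>T t. exp (- (s * g)) * (weight P xs * (\<Sum>r<t. f (rotate r (take t xs)))))"
    proof (intro sum_mono mult_left_mono)
      fix xs assume "xs \<in> T t"
      then have "length (take t xs) = t" using t by (auto simp: T_def words_def)
      then show "real t * exp (s * K t xs) \<le> (\<Sum>r<t. f (rotate r (take t xs)))"
        using exp_relent_rotate_average[of m "take t xs" s P] m t s by (simp add: K_def f_def)
    qed (auto simp: weight_nonneg)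
    also have "\<dots> = exp (- (s * g)) * (\<Sum>r<t. \<Sum>xs\<in>T t. weight P xs * f (rotate r (take t xs)))"
      by (subst sum.swap) (simp add: sum_distrib_left)
    \<comment> \<open>Each rotation contributes the same sum over \<open>T t\<close> as the
      unrotated prefix.\<close>
    also have "\<dots> = exp (- (s * g)) * (\<Sum>r<t. \<Sum>xs\<in>T t. weight P xs * f (take t xs))"
    proof -
      have "(\<Sum>xs\<in>T t. weight P xs * f (rotate r (take t xs))) = (\<Sum>xs\<in>T t. weight P xs * f (take t xs))"
        if "r < t" for r
      proof (rule sum_rotate_prefix)
        show "t \<le> n" "r \<le> t" "T t \<subseteq> words P n" using t that by (auto simp: T_def)
      qed (rule inv)
      then show ?thesis by simp
    qed
    also have "(\<Sum>xs\<in>T t. weight P xs * f (take t xs)) = (\<Sum>xs\<in>T t. weight P xs * exp (s * K m xs))"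
      using t by (simp add: f_def K_def min_absorb1)
    also have "exp (- (s * g)) * (\<Sum>r<t. \<dots>)
        = real t * (\<Sum>xs\<in>T t. exp (- (s * g)) * (weight P xs * exp (s * K m xs)))"
      by (simp add: sum_distrib_left[symmetric])
    finally show "(\<Sum>xs\<in>T t. weight P xs)
        \<le> (\<Sum>xs\<in>T t. exp (- (s * g)) * (weight P xs * exp (s * K m xs)))"
      using t m by simp
  qed
  also have "\<dots> = (\<Sum>xs\<in>(\<Union>t\<in>{m..n}. T t). exp (- (s * g)) * (weight P xs * exp (s * K m xs)))"
    using finT disj' by (simp add: sum.UNION_disjoint)
  \<comment> \<open>The terms are nonnegative, so the sum may be extended to all words.\<close>
  also have "\<dots> \<le> (\<Sum>xs\<in>words P n. exp (- (s * g)) * (weight P xs * exp (s * K m xs)))"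
    using finite_words[OF fin] by (intro sum_mono2) (auto simp: T_def weight_nonneg)
  also have "\<dots> = exp (- (s * g)) * (\<Sum>u\<in>words P m. weight P u * exp (s * relent P (mset u)))"
    using sum_weight_take[OF fin m(2), of "\<lambda>u. exp (s * relent P (mset u))"]
    by (simp add: K_def flip: sum_distrib_left)
  finally show ?thesis by (simp add: K_def)
qed

section \<open>The exponential moment of the divergence is at most \<open>G\<close>\<close>

text \<open>These words are rearrangements of one multiset, whose rearrangements number the
  multinomial coefficient. Equality can fail because some \<open>a i\<close> may have mass 0 and
  then occurs in no word.\<close>

lemma card_words_count_le:
  fixes a :: "nat \<Rightarrow> 'a"
  assumes inj: "inj_on a {1..k}" and supp: "set_pmf P \<subseteq> a ` {1..k}" and x: "x \<in> compositions k m"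
  shows "real (card {u \<in> words P m. \<forall>i\<in>{1..k}. count (mset u) (a i) = x i}) \<le> multinomial k m x"
proof -
  define A where "A = (\<Sum>i=1..k. replicate_mset (x i) (a i))"
  have count_A: "count A (a i) = x i" if "i \<in> {1..k}" for i
  proof -
    have "count A (a i) = (\<Sum>j=1..k. if j = i then x j else 0)"
      unfolding A_def count_sum using inj that
      by (intro sum.cong) (auto dest: inj_onD)
    then show ?thesis using that by simp
  qed
  have count_A': "count A b = 0" if "b \<notin> a ` {1..k}" for b
    unfolding A_def count_sum using that by (intro sum.neutral) auto
  have size_A: "size A = m"
    using x by (simp add: A_def size_multiset_sum compositions_def)
  have sub: "{u \<in> words P m. \<forall>i\<in>{1..k}. count (mset u) (a i) = x i} \<subseteq> permutations_of_multiset A"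
  proof
    fix u assume u: "u \<in> {u \<in> words P m. \<forall>i\<in>{1..k}. count (mset u) (a i) = x i}"
    have "count (mset u) b = count A b" for b
    proof (cases "b \<in> a ` {1..k}")
      case True
      then show ?thesis using u count_A by auto
    next
      case False
      then have "b \<notin> set u" using u supp by (auto simp: words_def)
      then show ?thesis using count_A'[OF False] by (simp add: count_mset_0_iff)
    qed
    then show "u \<in> permutations_of_multiset A"
      by (intro permutations_of_multisetI multiset_eqI) simp
  qed
  have sub_A: "set_mset A \<subseteq> a ` {1..k}"
    using count_A' by (metis count_eq_zero_iff subsetI)
  have "(\<Prod>i=1..k. fact (x i)) = (\<Prod>i=1..k. fact (count A (a i)) :: nat)"
    using count_A by (intro prod.cong) auto
  also have "\<dots> = (\<Prod>b\<in>a ` {1..k}. fact (count A b))"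
    using inj by (simp add: prod.reindex)
  also have "\<dots> = (\<Prod>b\<in>set_mset A. fact (count A b))"
    using sub_A by (intro prod.mono_neutral_right) (auto simp: not_in_iff)
  finally have "card (permutations_of_multiset A) * (\<Prod>i=1..k. fact (x i)) = fact m"
    using card_permutations_of_multiset_aux[of A] size_A by simp
  then have "real (card (permutations_of_multiset A)) * (\<Prod>i=1..k. fact (x i)) = fact m"
    by (metis (mono_tags, lifting) of_nat_fact of_nat_mult of_nat_prod prod.cong)
  then have "real (card (permutations_of_multiset A)) = multinomial k m x"
    by (simp add: multinomial_def field_simps)
  then show ?thesis
    using card_mono[OF _ sub] by simp
qed

text \<open>With y = c b / (m * pmf P b), the left side is the product over letters of
  \<open>(pmf P b * y powr l) ^ c b\<close>; each base is at most the mixture that appears in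
  \<open>G\<close>.\<close>

lemma weight_exp_relent_le:
  fixes a :: "nat \<Rightarrow> 'a"
  assumes inj: "inj_on a {1..k}" and supp: "set_pmf P \<subseteq> a ` {1..k}"
    and p: "\<And>j. j \<in> {1..k} \<Longrightarrow> p j = pmf P (a j)"
    and l: "0 \<le> l" "l \<le> 1" and m: "0 < m" and u: "u \<in> words P m"
  shows "weight P u * exp (l * m * relent P (mset u))
    \<le> (\<Prod>i=1..k. (l * real (count (mset u) (a i)) / m + (1 - l) * p i) ^ count (mset u) (a i))"
proof -
  define c where "c = count (mset u)"
  have fin: "finite (set_pmf P)" using supp finite_subset by blast
  have u': "set u \<subseteq> set_pmf P" "length u = m" using u by (auto simp: words_def)
  have c0: "c b = 0" if "b \<notin> set_pmf P" for b
    using u' that by (auto simp: c_def count_mset_0_iff)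
  have "weight P u = (\<Prod>b\<in>set_mset (mset u). pmf P b ^ c b)"
    unfolding weight_def c_def image_prod_mset_multiplicity[symmetric]
    by (simp flip: prod_mset_prod_list)
  also have "\<dots> = (\<Prod>b\<in>set_pmf P. pmf P b ^ c b)"
    using u' fin by (intro prod.mono_neutral_left) (auto simp: c_def iffD2[OF count_mset_0_iff])
  finally have w: "weight P u = (\<Prod>b\<in>set_pmf P. pmf P b ^ c b)" .
  have "l * m * relent P (mset u) = (\<Sum>b\<in>set_pmf P. l * c b * ln (c b / m / pmf P b))"
    unfolding relent_def sum_distrib_left using m u'
    by (intro sum.cong) (auto simp: c_def)
  then have "weight P u * exp (l * m * relent P (mset u))
      = (\<Prod>b\<in>set_pmf P. pmf P b ^ c b * exp (l * c b * ln (c b / m / pmf P b)))"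
    using fin by (simp add: w exp_sum prod.distrib)
  also have "\<dots> \<le> (\<Prod>b\<in>set_pmf P. (l * c b / m + (1 - l) * pmf P b) ^ c b)"
  proof (intro prod_mono conjI)
    fix b assume b: "b \<in> set_pmf P"
    then have pb: "pmf P b > 0" by (simp add: pmf_positive)
    show "pmf P b ^ c b * exp (l * c b * ln (c b / m / pmf P b)) \<le> (l * c b / m + (1 - l) * pmf P b) ^ c b"
    \<comment> \<open>For an absent letter the logarithm is taken at 0, but both sides are
      1.\<close>
    proof (cases "c b = 0")
      case False
      define y where "y = c b / m / pmf P b"
      have y: "y > 0" using False m pb by (simp add: y_def)
      \<comment> \<open>weighted AM-GM: \<open>y powr l \<le> l * y + (1 - l)\<close>\<close>
      have "exp ((1 - l) * 0 + l * ln y) \<le> (1 - l) * exp 0 + l * exp (ln y)"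
        using convex_onD[OF exp_convex, of l 0 "ln y"] l by simp
      then have "pmf P b * exp (l * ln y) \<le> pmf P b * (1 - l + l * y)"
        using y pb by (intro mult_left_mono) auto
      also have "\<dots> = l * c b / m + (1 - l) * pmf P b"
        using pb by (simp add: y_def field_simps)
      finally have "(pmf P b * exp (l * ln y)) ^ c b \<le> (l * c b / m + (1 - l) * pmf P b) ^ c b"
        using pb by (intro power_mono) auto
      moreover have "exp (l * ln y) ^ c b = exp (l * c b * ln y)"
        by (simp add: mult_ac flip: exp_of_nat_mult)
      ultimately show ?thesis by (simp add: power_mult_distrib y_def)
    qed simp
  qed auto
  \<comment> \<open>Letters of mass 0 do not occur in \<open>u\<close>, so the added factors are
    0-th powers.\<close>
  also have "\<dots> = (\<Prod>b\<in>a ` {1..k}. (l * c b / m + (1 - l) * pmf P b) ^ c b)"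
    using supp c0 by (intro prod.mono_neutral_left) auto
  also have "\<dots> = (\<Prod>i=1..k. (l * c (a i) / m + (1 - l) * pmf P (a i)) ^ c (a i))"
    using inj by (simp add: prod.reindex)
  also have "\<dots> = (\<Prod>i=1..k. (l * c (a i) / m + (1 - l) * p i) ^ c (a i))"
    using p by (intro prod.cong) auto
  finally show ?thesis by (simp add: c_def)
qed

text \<open>Words are grouped by count vector: the bound for a word depends on this vector alone,
  and each group has at most multinomially many words.\<close>

lemma sum_weight_exp_relent_le_G:
  fixes a :: "nat \<Rightarrow> 'a"
  assumes inj: "inj_on a {1..k}" and supp: "set_pmf P \<subseteq> a ` {1..k}"
    and p: "\<And>j. j \<in> {1..k} \<Longrightarrow> p j = pmf P (a j)"
    and l: "0 \<le> l" "l \<le> 1" and m: "0 < m"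
  shows "(\<Sum>u\<in>words P m. weight P u * exp (l * m * relent P (mset u))) \<le> G p k m l"
proof -
  have fin: "finite (set_pmf P)" using supp finite_subset by blast
  \<comment> \<open>The restriction makes \<open>cnt u\<close> extensional, like the members of
    \<open>compositions\<close>.\<close>
  define cnt where "cnt = (\<lambda>u. \<lambda>i\<in>{1..k}. count (mset u) (a i))"
  define H where "H = (\<lambda>x. \<Prod>i=1..k. (l * real (x i :: nat) / m + (1 - l) * p i) ^ x i)"
  have H_nonneg: "H x \<ge> 0" for x
    unfolding H_def using l p by (intro prod_nonneg) auto
  have "finite (compositions k m)"
    unfolding compositions_def by (intro finite_subset[OF _ finite_PiE[of "{1..k}" "\<lambda>_. {..m}"]]) auto
  moreover have "cnt ` words P m \<subseteq> compositions k m"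
  proof (intro image_subsetI)
    fix u assume "u \<in> words P m"
    then have u: "set u \<subseteq> set_pmf P" "length u = m" by (auto simp: words_def)
    have "(\<Sum>i=1..k. count (mset u) (a i)) = (\<Sum>b\<in>a ` {1..k}. count (mset u) b)"
      using inj by (simp add: sum.reindex)
    also have "\<dots> = size (mset u)"
      unfolding size_multiset_overloaded_eq using u supp
      by (intro sum.mono_neutral_right) (auto simp: count_mset_0_iff)
    finally show "cnt u \<in> compositions k m"
      using u count_le_size[of "mset u"] by (auto simp: cnt_def compositions_def)
  qed
  ultimately have grp: "(\<Sum>u\<in>words P m. H (cnt u))
      = (\<Sum>x\<in>compositions k m. \<Sum>u | u \<in> words P m \<and> cnt u = x. H (cnt u))"
    using finite_words[OF fin] by (intro sum.group[symmetric])
  have "(\<Sum>u\<in>words P m. weight P u * exp (l * m * relent P (mset u))) \<le> (\<Sum>u\<in>words P m. H (cnt u))"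
    using weight_exp_relent_le[OF inj supp p l m]
    by (intro sum_mono) (simp add: H_def cnt_def)
  also have "\<dots> \<le> (\<Sum>x\<in>compositions k m. multinomial k m x * H x)"
    unfolding grp
  proof (intro sum_mono)
    fix x assume x: "x \<in> compositions k m"
    then have "cnt u = x \<longleftrightarrow> (\<forall>i\<in>{1..k}. count (mset u) (a i) = x i)" for u
      by (auto simp: cnt_def compositions_def fun_eq_iff PiE_iff extensional_def restrict_def)
    then have "real (card {u \<in> words P m. cnt u = x}) \<le> multinomial k m x"
      using card_words_count_le[OF inj supp x] by simp
    then have "real (card {u \<in> words P m. cnt u = x}) * H x \<le> multinomial k m x * H x"
      using H_nonneg by (rule mult_right_mono)
    then show "(\<Sum>u | u \<in> words P m \<and> cnt u = x. H (cnt u)) \<le> multinomial k m x * H x"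
      by simp
  qed
  also have "\<dots> = G p k m l" by (simp add: G_def H_def)
  finally show ?thesis .
qed


section \<open>From words to the probability space\<close>

lemma pmf_empirical:
  assumes "t \<ge> 1"
  shows "pmf (empirical t xs) b = real (count (mset (map xs [1..<Suc t])) b) / real t"
proof -
  have "real (count (mset (map xs [1..<Suc t])) b) = (\<Sum>i=1..t. indicator {b} (xs i))"
    by (induction t) (auto simp: indicator_def)
  then show ?thesis
    using measure_empirical[OF assms, of xs "{b}"] by (simp add: pmf.rep_eq)
qed

text \<open>For observations inside the support the empirical law is absolutely continuous, and its
  finite support makes the log-density integrable, so \<open>KL\<close> takes its finite
  branch.\<close>

lemma KL_empirical:
  assumes fin: "finite (set_pmf P)" and t: "t \<ge> 1" and xs: "\<And>i. i \<in> {1..t} \<Longrightarrow> xs i \<in> set_pmf P"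
  shows "KL (empirical t xs) P = ereal (relent P (mset (map xs [1..<Suc t])))"
proof -
  define Q where "Q = empirical t xs"
  define f where "f = (\<lambda>b. pmf Q b / pmf P b)"
  have supp: "set_pmf Q \<subseteq> set_pmf P"
    using t xs by (auto simp: Q_def empirical_def)
  \<comment> \<open>Off the support both masses are 0, so \<open>f\<close> is a density of
    \<open>Q\<close> with respect to \<open>P\<close>.\<close>
  have "pmf Q b = pmf P b * f b" for b
    using supp by (cases "b \<in> set_pmf P") (auto simp: f_def set_pmf_iff)
  then have "density P (\<lambda>b. ennreal (f b)) = measure_pmf Q"
    by (simp add: measure_pmf_eq_density density_density_eq f_def flip: ennreal_mult')
  then have Q: "measure_pmf Q = density P (\<lambda>b. ennreal (f b))" by simp
  have "KL_divergence (exp 1) P Q = (\<integral>b. f b * log (exp 1) (f b) \<partial>P)"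
    unfolding Q
    by (rule sigma_finite_measure.KL_density[OF measure_pmf.sigma_finite_measure_axioms])
       (auto simp: f_def)
  also have "\<dots> = (\<Sum>b\<in>set_pmf P. pmf P b * (f b * ln (f b)))"
    using fin by (subst integral_measure_pmf_real[where A = "set_pmf P"])
                 (auto simp: log_ln mult_ac)
  also have "\<dots> = (\<Sum>b\<in>set_pmf P. pmf Q b * ln (pmf Q b / pmf P b))"
    by (intro sum.cong) (auto simp: f_def set_pmf_iff)
  also have "\<dots> = relent P (mset (map xs [1..<Suc t]))"
    unfolding relent_def Q_def using pmf_empirical[OF t, of xs] by simp
  finally have "KL_divergence (exp 1) P Q = relent P (mset (map xs [1..<Suc t]))" .
  moreover have "absolutely_continuous P Q"
    unfolding Q by (rule absolutely_continuousI_density) simp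
  moreover have "integrable Q (entropy_density (exp 1) P Q)"
    using finite_subset[OF supp fin] by (rule integrable_measure_pmf_finite)
  ultimately show ?thesis by (simp add: KL_def Q_def)
qed

text \<open>\<open>E xs\<close> is the cylinder on which the sample spells \<open>xs\<close>.
  Independence gives it probability \<open>weight P xs\<close>; the estimate is a union bound over
  \<open>S\<close>.\<close>

lemma (in prob_space)
  fixes X :: "nat \<Rightarrow> 'a \<Rightarrow> 'b"
  assumes indep: "indep_vars (\<lambda>_. count_space UNIV) X {1..}"
    and distr: "\<And>t. t \<ge> 1 \<Longrightarrow> distr M (count_space UNIV) (X t) = measure_pmf P"
    and n: "n \<ge> 1" and S: "finite S" "\<And>xs. xs \<in> S \<Longrightarrow> length xs = n"
  shows measurable_words: "{\<omega> \<in> space M. map (\<lambda>i. X i \<omega>) [1..<Suc n] \<in> S} \<in> events"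
    and prob_words_le: "prob {\<omega> \<in> space M. map (\<lambda>i. X i \<omega>) [1..<Suc n] \<in> S} \<le> (\<Sum>xs\<in>S. weight P xs)"
proof -
  define E where "E = (\<lambda>xs. \<Inter>i\<in>{1..n}. X i -` {xs ! (i - 1)} \<inter> space M)"
  have X: "random_variable (count_space UNIV) (X i)" if "i \<ge> 1" for i
    using indep that by (auto simp: indep_vars_def)
  have eq: "{\<omega> \<in> space M. map (\<lambda>i. X i \<omega>) [1..<Suc n] \<in> S} = (\<Union>xs\<in>S. E xs)"
  proof -
    \<comment> \<open>Observations are indexed from 1, list positions from 0.\<close>
    have "map (\<lambda>i. X i \<omega>) [1..<Suc n] = xs \<longleftrightarrow> (\<forall>i\<in>{1..n}. X i \<omega> = xs ! (i - 1))"
      if "xs \<in> S" for xs \<omega>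
    proof -
      have "map (\<lambda>i. X i \<omega>) [1..<Suc n] = xs \<longleftrightarrow> (\<forall>i<n. X (Suc i) \<omega> = xs ! i)"
        using S(2)[OF that] by (auto simp: list_eq_iff_nth_eq simp del: upt_Suc)
      also have "\<dots> \<longleftrightarrow> (\<forall>i\<in>{1..n}. X i \<omega> = xs ! (i - 1))"
        unfolding image_Suc_lessThan[symmetric] ball_simps by auto
      finally show ?thesis .
    qed
    \<comment> \<open>An empty intersection would be the whole type; \<open>n >= 1\<close> puts
      \<open>E xs\<close> inside \<open>space M\<close>.\<close>
    moreover have "\<omega> \<in> E xs \<longleftrightarrow> \<omega> \<in> space M \<and> (\<forall>i\<in>{1..n}. X i \<omega> = xs ! (i - 1))" for xs \<omega>
      using n by (auto simp: E_def)
    ultimately show ?thesis using S by (intro set_eqI) (simp del: upt_Suc, metis)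
  qed
  have E: "E xs \<in> events" for xs
    unfolding E_def using n by (intro sets.finite_INT measurable_sets[OF X]) auto
  then show "{\<omega> \<in> space M. map (\<lambda>i. X i \<omega>) [1..<Suc n] \<in> S} \<in> events"
    unfolding eq using S by auto
  have single: "prob (X i -` {b} \<inter> space M) = pmf P b" if "i \<ge> 1" for i b
    using measure_distr[OF X[OF that], of "{b}"] distr[OF that] by (simp add: pmf.rep_eq)
  have prob_E: "prob (E xs) = weight P xs" if "xs \<in> S" for xs
  proof -
    have "prob (E xs) = (\<Prod>i\<in>{1..n}. pmf P (xs ! (i - 1)))"
      unfolding E_def using n by (subst indep_varsD[OF indep]) (auto simp: single)
    also have "\<dots> = (\<Prod>i<n. pmf P (xs ! i))"
      by (rule prod.reindex_bij_witness[where i = Suc and j = "\<lambda>i. i - 1"]) auto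
    also have "\<dots> = weight P xs"
      using S(2)[OF that] by (simp add: weight_def prod.list_conv_set_nth atLeast0LessThan)
    finally show ?thesis .
  qed
  show "prob {\<omega> \<in> space M. map (\<lambda>i. X i \<omega>) [1..<Suc n] \<in> S} \<le> (\<Sum>xs\<in>S. weight P xs)"
    unfolding eq using S(1) E finite_measure_subadditive_finite[of S E] by (simp add: prob_E image_subset_iff)
qed

section \<open>Summing over the dyadic blocks\<close>

text \<open>The factor 2 in the threshold squares d / (g * L). One copy absorbs the moment
  \<open>g\<close> and leaves d / L; the other is at most 1.\<close>

lemma exp_threshold_mult_G_le:
  fixes g L d l :: real
  assumes "0 < d" "d < 1" "1 \<le> g" "1 \<le> L" "0 < l" "0 < m"
  shows "exp (- (2 * l * real m * (2 / (l * real (2 * m)) * ln (g * L / d)))) * g \<le> d / L"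
proof -
  define R where "R = g * L / d"
  have R: "R > 0" using assms by (simp add: R_def)
  have "2 * l * real m * (2 / (l * real (2 * m)) * ln R) = 2 * ln R"
    using assms by (simp add: field_simps)
  also have "exp (- (2 * ln R)) = (inverse R)\<^sup>2"
    using R exp_of_nat_mult[of 2 "ln R"] by (simp add: exp_minus power_inverse)
  also have "(inverse R)\<^sup>2 * g = (d / L) * (d / (g * L))"
    using assms by (simp add: R_def field_simps power2_eq_square)
  also have "\<dots> \<le> (d / L) * 1"
  proof (intro mult_left_mono)
    have "1 * 1 \<le> g * L" using assms by (intro mult_mono) auto
    then show "d / (g * L) \<le> 1" using assms by (simp add: divide_le_eq)
  qed (use assms in auto)
  finally show ?thesis by (simp add: R_def)
qed

text \<open>Together with \<open>sum_weight_exp_relent_le_G\<close> this gives \<open>G\<close> at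
  least 1 without expanding it.\<close>

lemma one_le_sum_weight_exp_relent:
  assumes fin: "finite (set_pmf P)" and "0 < m" "0 \<le> s"
  shows "1 \<le> (\<Sum>u\<in>words P m. weight P u * exp (s * relent P (mset u)))"
proof -
  have "1 = (\<Sum>u\<in>words P m. weight P u * 1)"
    using sum_weight_words[OF fin] by simp
  also have "\<dots> \<le> (\<Sum>u\<in>words P m. weight P u * exp (s * relent P (mset u)))"
  proof (intro sum_mono mult_left_mono weight_nonneg)
    fix u assume "u \<in> words P m"
    then have "relent P (mset u) \<ge> 0"
      using assms by (intro relent_nonneg) (auto simp: words_def)
    then show "1 \<le> exp (s * relent P (mset u))" using assms by simp
  qed
  finally show ?thesis .
qed



theorem proposition7:
  fixes M :: "'b measure" and X :: "nat \<Rightarrow> 'b \<Rightarrow> 'a"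
    and P :: "'a pmf" and a :: "nat \<Rightarrow> 'a" and k :: nat and p :: "nat \<Rightarrow> real"
    and \<delta> :: real and ell :: "real \<Rightarrow> real" and lam \<gamma> :: "nat \<Rightarrow> real"
  assumes "0 < \<delta>" "\<delta> < 1"
    and "k \<ge> 2"
    and "inj_on a {1..k}"
    and "set_pmf P \<subseteq> a ` {1..k}"
    and "\<And>j. j \<in> {1..k} \<Longrightarrow> p j = measure P {a j}"
    and "prob_space M"
    and "prob_space.indep_vars M (\<lambda>_. count_space UNIV) X {1..}"
    and "\<And>t. t \<ge> 1 \<Longrightarrow> distr M (count_space UNIV) (X t) = measure_pmf P"
    and "\<And>x. x \<ge> 0 \<Longrightarrow> ell x \<ge> 1"
    and "summable (\<lambda>j. 1 / ell (real (Suc j)))"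
    and "(\<Sum>j. 1 / ell (real (Suc j))) \<le> 1"
    and "\<And>x. x \<in> {0..1} \<Longrightarrow> ell x = ell 1"
    and "antimono_on {1..} (\<lambda>u. 2 powr (-u) * ln (ell u))"
    and "\<And>t. t \<ge> 1 \<Longrightarrow> lam t \<in> {0<..1/2}"
    and "\<And>t. t \<ge> 1 \<Longrightarrow> \<gamma> t = threshold p k ell lam \<delta> t"
    and "antimono_on {1..} \<gamma>"
  shows "measure M {\<omega> \<in> space M. \<exists>t\<ge>1.
           KL (empirical t (\<lambda>i. X i \<omega>)) P \<ge> ereal (\<gamma> t)} \<le> \<delta>"
proof -
  interpret prob_space M by fact
  note \<delta> = assms(1,2)
  note indep = assms(8) and distr = assms(9)
  have fin: "finite (set_pmf P)" using assms(5) finite_subset by blast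
  have pP: "p j = pmf P (a j)" if "j \<in> {1..k}" for j
    using assms(6)[OF that] by (simp add: pmf.rep_eq)
  \<comment> \<open>The block runs from \<open>2 ^ j\<close> to \<open>T j - 1\<close>, so words of
    length \<open>T j - 1\<close> carry all of it. The level is taken at \<open>T j\<close>, where
    \<open>T j div 2\<close> is the start of the block.\<close>
  define T where "T = (\<lambda>j::nat. 2 ^ Suc j :: nat)"
  define S where "S = (\<lambda>j. {xs \<in> words P (T j - 1).
      \<exists>t\<in>{2 ^ j..T j - 1}. relent P (mset (take t xs)) \<ge> \<gamma> (T j)})"
  define B where "B = (\<lambda>j. {\<omega> \<in> space M. map (\<lambda>i. X i \<omega>) [1..<Suc (T j - 1)] \<in> S j})"
  have T: "T j \<ge> 2" "2 ^ j \<le> T j - 1" "T j = 2 * 2 ^ j" for j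
    using one_le_power[of "2::nat" j] by (auto simp: T_def)
  have T1: "1 \<le> T j - 1" for j using T(1)[of j] by simp
  have finS: "finite (S j)" and lenS: "xs \<in> S j \<Longrightarrow> length xs = T j - 1" for j xs
    using finite_words[OF fin] by (auto simp: S_def, auto simp: words_def)
  have B: "B j \<in> events" for j
    unfolding B_def by (rule measurable_words[OF indep distr T1 finS lenS])
  have prob_B: "prob (B j) \<le> \<delta> / ell (real (Suc j))" for j
  proof -
    define l where "l = lam (T j)"
    define m :: nat where "m = 2 ^ j"
    have m: "m > 0" "T j = 2 * m" by (simp_all add: m_def T)
    \<comment> \<open>\<open>2 * l\<close> is the mixing weight in \<open>G\<close>; the bound 1/2
      on \<open>lam\<close> keeps it at most 1.\<close>
    have l: "0 < l" "2 * l \<le> 1" using assms(15)[of "T j"] T(1)[of j] by (auto simp: l_def)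
    define F where "F = (\<Sum>u\<in>words P m. weight P u * exp (2 * l * m * relent P (mset u)))"
    have F: "1 \<le> F" "F \<le> G p k m (2 * l)"
      unfolding F_def
      using one_le_sum_weight_exp_relent[OF fin] sum_weight_exp_relent_le_G[OF assms(4,5) pP] l m
      by simp_all
    \<comment> \<open>Hence \<open>ell\<close> is evaluated at j + 1, matching the terms of its
      series.\<close>
    have "log 2 (real (T j)) = real (Suc j)"
      unfolding T_def by (simp add: log_nat_power del: power_Suc)
    moreover have "T j div 2 = m" using m by simp
    moreover have "\<gamma> (T j) = threshold p k ell lam \<delta> (T j)" using T(1)[of j] by (intro assms(16)) simp
    ultimately have \<gamma>: "\<gamma> (T j) = 2 / (l * real (2 * m)) * ln (G p k m (2 * l) * ell (real (Suc j)) / \<delta>)"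
      using m(2) by (simp add: threshold_def l_def)
    have "prob (B j) \<le> (\<Sum>xs\<in>S j. weight P xs)"
      unfolding B_def by (rule prob_words_le[OF indep distr T1 finS lenS])
    also have "\<dots> \<le> exp (- (2 * l * m * \<gamma> (T j))) * F"
      unfolding S_def F_def m_def
      using fin l T(2) by (intro sum_weight_maximal) auto
    also have "\<dots> \<le> exp (- (2 * l * m * \<gamma> (T j))) * G p k m (2 * l)"
      using F by (intro mult_left_mono) auto
    also have "\<dots> \<le> \<delta> / ell (real (Suc j))"
      unfolding \<gamma> using \<delta> F l m assms(10)[of "real (Suc j)"]
      by (intro exp_threshold_mult_G_le) auto
    finally show ?thesis .
  qed
  \<comment> \<open>Off the null event \<open>N\<close> all observations lie in the support, as
    \<open>KL_empirical\<close> requires.\<close>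
  define N where "N = (\<Union>i. X (Suc i) -` (- set_pmf P) \<inter> space M)"
  have X: "random_variable (count_space UNIV) (X i)" if "i \<ge> 1" for i
    using indep that by (auto simp: indep_vars_def)
  have N: "N \<in> null_sets M"
    unfolding N_def
  proof (rule null_sets_UN)
    fix i
    have "emeasure M (X (Suc i) -` (- set_pmf P) \<inter> space M) = emeasure P (- set_pmf P)"
      using emeasure_distr[OF X[of "Suc i"], of "- set_pmf P"] distr[of "Suc i"] by simp
    also have "\<dots> = 0"
      by (simp add: measure_pmf.emeasure_eq_measure measure_pmf_zero_iff)
    finally show "X (Suc i) -` (- set_pmf P) \<inter> space M \<in> null_sets M"
      using X[of "Suc i"] by (intro null_setsI measurable_sets) auto
  qed
  have sub: "{\<omega> \<in> space M. \<exists>t\<ge>1. KL (empirical t (\<lambda>i. X i \<omega>)) P \<ge> ereal (\<gamma> t)} \<subseteq> N \<union> (\<Union>j. B j)"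
  proof (intro subsetI)
    fix \<omega> assume "\<omega> \<in> {\<omega> \<in> space M. \<exists>t\<ge>1. KL (empirical t (\<lambda>i. X i \<omega>)) P \<ge> ereal (\<gamma> t)}"
    then obtain t where \<omega>: "\<omega> \<in> space M" and t: "t \<ge> 1"
      and KL: "KL (empirical t (\<lambda>i. X i \<omega>)) P \<ge> ereal (\<gamma> t)" by auto
    show "\<omega> \<in> N \<union> (\<Union>j. B j)"
    proof (cases "\<omega> \<in> N")
      case False
      have V: "X i \<omega> \<in> set_pmf P" if "i \<ge> 1" for i
        using False \<omega> that by (cases i) (auto simp: N_def)
      obtain j where j: "2 ^ j \<le> t" "t < T j"
        using ex_power_ivl1[of 2 t] t by (auto simp: T_def)
      define xs where "xs = map (\<lambda>i. X i \<omega>) [1..<Suc (T j - 1)]"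
      have "take t xs = map (\<lambda>i. X i \<omega>) [1..<Suc t]"
        using j unfolding xs_def by (subst take_map, subst take_upt) auto
      \<comment> \<open>Since t < \<open>T j\<close>, monotonicity turns a crossing of the moving
        threshold into one of the constant block level.\<close>
      moreover have "\<gamma> (T j) \<le> \<gamma> t"
        using assms(17) t j by (auto simp: monotone_on_def)
      ultimately have "relent P (mset (take t xs)) \<ge> \<gamma> (T j)"
        using KL KL_empirical[OF fin t, of "\<lambda>i. X i \<omega>"] V by simp
      moreover have "xs \<in> words P (T j - 1)"
        using V by (auto simp: xs_def words_def simp del: upt_Suc)
      moreover have "t \<in> {2 ^ j..T j - 1}" using j by auto
      ultimately have "xs \<in> S j" by (auto simp: S_def)
      then have "\<omega> \<in> B j" unfolding B_def xs_def using \<omega> by blast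
      then show ?thesis by auto
    qed simp
  qed
  have sum_ell: "summable (\<lambda>j. \<delta> / ell (real (Suc j)))"
    using summable_mult[OF assms(11), of \<delta>] by simp
  have sum_B: "summable (\<lambda>j. prob (B j))"
    by (rule summable_comparison_test'[OF sum_ell, of 0]) (use prob_B in simp)
  have UB: "(\<Union>j. B j) \<in> events" using B by auto
  have "measure M {\<omega> \<in> space M. \<exists>t\<ge>1. KL (empirical t (\<lambda>i. X i \<omega>)) P \<ge> ereal (\<gamma> t)}
      \<le> prob (N \<union> (\<Union>j. B j))"
    using sub N UB by (intro finite_measure_mono) auto
  also have "\<dots> = prob (\<Union>j. B j)"
    unfolding Un_commute[of N] using UB N by (rule measure_Un_null_set)
  also have "\<dots> \<le> (\<Sum>j. prob (B j))"
    using B sum_B by (intro finite_measure_subadditive_countably) auto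
  also have "\<dots> \<le> (\<Sum>j. \<delta> / ell (real (Suc j)))"
    using prob_B sum_B sum_ell by (rule suminf_le)
  also have "\<dots> = \<delta> * (\<Sum>j. 1 / ell (real (Suc j)))"
    using suminf_mult[OF assms(11), of \<delta>] by simp
  also have "\<dots> \<le> \<delta>"
    using \<delta> assms(12) by (simp add: mult_left_le)
  finally show ?thesis .
qed

end
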